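(* Let $\pi:\Delta^m\to\Delta^k$ be a fine and connected multivariate ladder. For $\boldsymbol p\in\Delta^m$ let $P=P(\boldsymbol p)$ be the $(k+1)\times(k+1)$ matrix on $\Omega=\{0,\dots,k\}$ with $$P_{i,j}=\begin{cases}V_{i,j}W_{i,j}& i\ne j,\\ 1-\sum_{h\ne i}P_{i,h}& i=j,\end{cases}$$ where, for $i\neq j$, $W_{i,j}=p_b$ if $j\in\mathcal N_b(i)$ and $W_{i,j}=0$ if $j\notin\mathcal N(i)$, and $V$ is the matrix produced by the greedy algorithm described in the context. Then, for every $\boldsymbol p\in\Delta^m$, $P$ is the transition matrix of a time-reversible Markov chain $(X_t)_{t\in\mathbb N}$ on $\Omega$ that admits $\pi(\boldsymbol p)$ as its unique stationary distribution.
   Context: $\Delta^m=\{\boldsymbol p=(p_0,\dots,p_m)\in(0,1)^{m+1}:\sum_i p_i=1\}$, with closure $\bar\Delta^m$; elements of $\Delta^k$ are probability distributions on $\{0,\dots,k\}$. Multivariate ladder: a map $\pi:\Delta^m\to\Delta^k$ of the form $\pi_i(\boldsymbol p)=R_i\prod_{j=0}^m p_j^{n_{i,j}}/C(\boldsymbol p)$, where $C$ is a real polynomial without roots in $\bar\Delta^m$, $R_i>0$ are constants, $n_{i,j}$ are non-negative integers and $\boldsymbol n_i=(n_{i,0},\dots,n_{i,m})$ satisfies $\|\boldsymbol n_i\|_1=d$ for all $i$, for some integer $d$. Connected: any two states $i,j$ are joined by a sequence of states $i=s_1,\dots,s_t=j$ with $\|\boldsymbol n_{s_h}-\boldsymbol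 n_{s_{h-1}}\|_1\le2$. Fine: $\boldsymbol n_i=\boldsymbol n_j$ implies $i=j$. Neighbourhoods: for $b\in\{0,\dots,m\}$ let $\boldsymbol e_b$ be the $b$-th standard unit vector of $\mathbb R^{m+1}$ (indices start at 0); $\mathcal N_b(i)=\{j\in\Omega\setminus\{i\}:\|\boldsymbol n_i-\boldsymbol n_j+\boldsymbol e_b\|_1=1\}$ and $\mathcal N(i)=\bigcup_b\mathcal N_b(i)=\{j\ne i:\|\boldsymbol n_i-\boldsymbol n_j\|_1\le 2\}$. For a fine ladder each $j\in\mathcal N(i)$ lies in exactly one $\mathcal N_b(i)$. Greedy algorithm for $V$. Start with $V=0$, working sets $M_b(i):=\mathcal N_b(i)$, numbers $S_b(i):=\sum_{j\in\mathcal N_b(i)}R_j$ and weights $\omega_b(i):=0$, for all $i\in\Omega$, $b\in\{0,\dots,m\}$. Repeat until all sets $M_b(i)$ are empty: choose $(b,i)$ maximising $S_b(i)$ (ties broken arbitrarily) and put $s:=S_b(i)$; for each $j$ in the current $M_b(i)$: set $V_{i,j}:=R_j/s$, remove $j$ from $M_b(i)$ and increase $\omega_b(i)$ by $R_j/s$; let $c$ be the index with $i\in\mathcal N_c(j)$, set $V_{j,i}:=R_i/s$, remove $i$ from $M_c(j)$, increase $\omega_c(j)$ by $R_i/s$, and update $S_c(j):=\big(\sum_{h\in M_c(j)}R_h\big)/(1-\omega_c(j))$ (with $S_c(j):=0$ if $M_c(j)=\emptyset$). After all such $j$ have been processed, set $S_b(i):=0$. *)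

theory Defs
  imports "HOL-Probability.Probability"
begin

text \<open>
  A coordinate set \<open>{0, \<dots>, m}\<close> is rendered by a finite index type with \<open>m + 1\<close> elements:
  \<open>'m\<close> indexes the coordinates of \<open>p\<close>, and \<open>'k\<close> is the state space \<open>\<Omega> = {0, \<dots>, k}\<close>.
\<close>

definition open_simplex :: "(real ^ 'a::finite) set" where
  "open_simplex = {p. (\<forall>i. 0 < p $ i \<and> p $ i < 1) \<and> (\<Sum>i\<in>UNIV. p $ i) = 1}"

definition l1_norm :: "('m::finite \<Rightarrow> int) \<Rightarrow> int" where
  "l1_norm v = (\<Sum>a\<in>UNIV. \<bar>v a\<bar>)"

definition multivariate_ladder ::
  "(real ^ 'm::finite \<Rightarrow> real ^ 'k::finite) \<Rightarrow> ('k \<Rightarrow> real) \<Rightarrow> ('k \<Rightarrow> 'm \<Rightarrow> nat)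
    \<Rightarrow> (real ^ 'm \<Rightarrow> real) \<Rightarrow> bool" where
  "multivariate_ladder \<pi> R n C \<longleftrightarrow>
     real_polynomial_function C \<and>
     (\<forall>p \<in> closure open_simplex. C p \<noteq> 0) \<and>
     (\<forall>i. 0 < R i) \<and>
     (\<exists>d. \<forall>i. l1_norm (\<lambda>a. int (n i a)) = d) \<and>
     (\<forall>p \<in> open_simplex. \<pi> p \<in> open_simplex \<and>
        (\<forall>i. \<pi> p $ i = R i * (\<Prod>j\<in>UNIV. (p $ j) ^ n i j) / C p))"

definition connected_ladder :: "('k \<Rightarrow> 'm::finite \<Rightarrow> nat) \<Rightarrow> bool" where
  "connected_ladder n \<longleftrightarrow>
     (\<forall>i j. \<exists>ss. ss \<noteq> [] \<and> hd ss = i \<and> last ss = j \<and>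
        (\<forall>h. Suc h < length ss \<longrightarrow>
           l1_norm (\<lambda>a. int (n (ss ! Suc h) a) - int (n (ss ! h) a)) \<le> 2))"

definition fine_ladder :: "('k \<Rightarrow> 'm \<Rightarrow> nat) \<Rightarrow> bool" where
  "fine_ladder n \<longleftrightarrow> (\<forall>i j. n i = n j \<longrightarrow> i = j)"

definition nbhd :: "('k \<Rightarrow> 'm::finite \<Rightarrow> nat) \<Rightarrow> 'm \<Rightarrow> 'k \<Rightarrow> 'k set" where
  "nbhd n b i =
     {j. j \<noteq> i \<and> l1_norm (\<lambda>a. int (n i a) - int (n j a) + (if a = b then 1 else 0)) = 1}"

text \<open>The greedy algorithm. The functions are indexed by the pairs \<open>(i, j)\<close> for the entries of
  \<open>V\<close>, and by the pairs \<open>(b, i)\<close> for \<open>M\<^sub>b(i)\<close>, \<open>S\<^sub>b(i)\<close> and \<open>\<omega>\<^sub>b(i)\<close>.\<close>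

record ('k, 'm) greedy_state =
  entryV :: "'k \<times> 'k \<Rightarrow> real"
  setM :: "'m \<times> 'k \<Rightarrow> 'k set"
  scoreS :: "'m \<times> 'k \<Rightarrow> real"
  weight :: "'m \<times> 'k \<Rightarrow> real"

definition greedy_init ::
  "('k::finite \<Rightarrow> real) \<Rightarrow> ('k \<Rightarrow> 'm::finite \<Rightarrow> nat) \<Rightarrow> ('k, 'm) greedy_state" where
  "greedy_init R n =
     \<lparr> entryV = (\<lambda>_. 0),
       setM = (\<lambda>(b, i). nbhd n b i),
       scoreS = (\<lambda>(b, i). \<Sum>j\<in>nbhd n b i. R j),
       weight = (\<lambda>_. 0) \<rparr>"

text \<open>Processing one \<open>j \<in> M\<^sub>b(i)\<close>. The updates at \<open>(b, i)\<close> and at \<open>(c, j)\<close> do not interfere,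
  since \<open>j \<noteq> i\<close>.\<close>

definition greedy_process ::
  "('k::finite \<Rightarrow> real) \<Rightarrow> ('k \<Rightarrow> 'm::finite \<Rightarrow> nat) \<Rightarrow> real \<Rightarrow> 'm \<Rightarrow> 'k \<Rightarrow> 'k
    \<Rightarrow> ('k, 'm) greedy_state \<Rightarrow> ('k, 'm) greedy_state" where
  "greedy_process R n s b i j st =
     (let c = (THE c. i \<in> nbhd n c j);
          Mc = setM st (c, j) - {i};
          wc = weight st (c, j) + R i / s
      in \<lparr> entryV = (entryV st)((i, j) := R j / s, (j, i) := R i / s),
           setM = (setM st)((b, i) := setM st (b, i) - {j}, (c, j) := Mc),
           scoreS = (scoreS st)((c, j) := if Mc = {} then 0 else (\<Sum>h\<in>Mc. R h) / (1 - wc)),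
           weight = (weight st)((b, i) := weight st (b, i) + R j / s, (c, j) := wc) \<rparr>)"

text \<open>One round of the main loop; the list \<open>js\<close> is an arbitrary processing order of
  \<open>M\<^sub>b(i)\<close>.\<close>

inductive greedy_step ::
  "('k::finite \<Rightarrow> real) \<Rightarrow> ('k \<Rightarrow> 'm::finite \<Rightarrow> nat)
    \<Rightarrow> ('k, 'm) greedy_state \<Rightarrow> ('k, 'm) greedy_state \<Rightarrow> bool"
  for R n where
  "\<lbrakk> \<exists>x. setM st x \<noteq> {};
     \<forall>x. scoreS st x \<le> scoreS st (b, i);
     distinct js; set js = setM st (b, i);
     st1 = fold (greedy_process R n (scoreS st (b, i)) b i) js st \<rbrakk>
   \<Longrightarrow> greedy_step R n st (st1\<lparr>scoreS := (scoreS st1)((b, i) := 0)\<rparr>)"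

text \<open>Ties are broken arbitrarily, so the output is a relation: \<open>V\<close> is produced by some
  terminating run.\<close>

definition greedy_output ::
  "('k::finite \<Rightarrow> real) \<Rightarrow> ('k \<Rightarrow> 'm::finite \<Rightarrow> nat) \<Rightarrow> real ^ 'k ^ 'k \<Rightarrow> bool" where
  "greedy_output R n V \<longleftrightarrow>
     (\<exists>st. (greedy_step R n)\<^sup>*\<^sup>* (greedy_init R n) st \<and> (\<forall>x. setM st x = {}) \<and>
        V = (\<chi> i j. entryV st (i, j)))"

definition weightW :: "('k \<Rightarrow> 'm::finite \<Rightarrow> nat) \<Rightarrow> real ^ 'm \<Rightarrow> 'k \<Rightarrow> 'k \<Rightarrow> real" where
  "weightW n p i j =
     (if j \<in> (\<Union>b. nbhd n b i) then p $ (THE b. j \<in> nbhd n b i) else 0)"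

definition ladder_matrix ::
  "real ^ 'k ^ 'k \<Rightarrow> ('k::finite \<Rightarrow> 'm::finite \<Rightarrow> nat) \<Rightarrow> real ^ 'm \<Rightarrow> real ^ 'k ^ 'k" where
  "ladder_matrix V n p =
     (\<chi> i j. if i \<noteq> j then V $ i $ j * weightW n p i j
             else 1 - (\<Sum>h\<in>UNIV - {i}. V $ i $ h * weightW n p i h))"

definition prob_vector :: "real ^ 'k::finite \<Rightarrow> bool" where
  "prob_vector v \<longleftrightarrow> (\<forall>i. 0 \<le> v $ i) \<and> (\<Sum>i\<in>UNIV. v $ i) = 1"

definition stochastic_matrix :: "real ^ 'k ^ 'k::finite \<Rightarrow> bool" where
  "stochastic_matrix P \<longleftrightarrow> (\<forall>i. prob_vector (P $ i))"

definition stationary_distribution :: "real ^ 'k ^ 'k::finite \<Rightarrow> real ^ 'k \<Rightarrow> bool" where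
  "stationary_distribution P v \<longleftrightarrow> prob_vector v \<and> v v* P = v"

definition markov_chain ::
  "'w measure \<Rightarrow> (nat \<Rightarrow> 'w \<Rightarrow> 'k::finite) \<Rightarrow> real ^ 'k ^ 'k \<Rightarrow> bool" where
  "markov_chain M X P \<longleftrightarrow>
     prob_space M \<and> (\<forall>t. X t \<in> measurable M (count_space UNIV)) \<and> stochastic_matrix P \<and>
     (\<forall>t x. \<P>(w in M. \<forall>s\<le>t. X s w = x s) > 0 \<longrightarrow>
        \<P>(w in M. X (Suc t) w = x (Suc t) \<bar> \<forall>s\<le>t. X s w = x s) = P $ x t $ x (Suc t))"

text \<open>Invariance in law under time reversal. For a chain with transition matrix \<open>P\<close> and initial law
  \<open>v\<close>, the case \<open>t = 1\<close> is the detailed balance equation \<open>v\<^sub>i P\<^sub>i\<^sub>j = v\<^sub>j P\<^sub>j\<^sub>i\<close>; summing it over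
  \<open>i\<close> shows that \<open>v\<close> is stationary.\<close>

definition time_reversible :: "'w measure \<Rightarrow> (nat \<Rightarrow> 'w \<Rightarrow> 'k) \<Rightarrow> bool" where
  "time_reversible M X \<longleftrightarrow>
     (\<forall>t x. \<P>(w in M. \<forall>s\<le>t. X s w = x s) = \<P>(w in M. \<forall>s\<le>t. X (t - s) w = x s))"

end

theory Submission
  imports Defs
begin

text \<open>
  For \<open>j \<in> \<N>\<^sub>b(i)\<close> and \<open>i \<in> \<N>\<^sub>c(j)\<close> the exponents satisfy \<open>n\<^sub>i + e\<^sub>b = n\<^sub>j + e\<^sub>c\<close>, and the greedy
  algorithm sets \<open>V\<^sub>i\<^sub>j = R\<^sub>j / s\<close> and \<open>V\<^sub>j\<^sub>i = R\<^sub>i / s\<close> with the same \<open>s\<close>; this gives detailed balance.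
  The matrix is stochastic because \<open>\<Sum>\<^sub>j V\<^sub>i\<^sub>j \<le> 1\<close> over each \<open>\<N>\<^sub>b(i)\<close>: the unresolved neighbours in
  \<open>M\<^sub>c(j)\<close> have total rate \<open>S\<^sub>c(j) (1 - \<omega>\<^sub>c(j)) \<le> s (1 - \<omega>\<^sub>c(j))\<close> by maximality of \<open>s\<close>, so resolving
  some of them at scale \<open>s\<close> never pushes \<open>\<omega>\<^sub>c(j)\<close> above \<open>1\<close>. Uniqueness is the maximum principle for
  the function \<open>v\<^sub>i / \<pi>\<^sub>i\<close>, which is harmonic by reversibility, on a connected state space.
\<close>

section \<open>Reversible finite Markov chains\<close>


lemma prob_vector_pmf:
  assumes "prob_vector v"
  obtains q where "\<And>i. pmf q i = v $ i"
proof
  fix i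
  show "pmf (embed_pmf (($) v)) i = v $ i"
  proof (rule pmf_embed_pmf)
    show "(\<integral>\<^sup>+ x. ennreal (v $ x) \<partial>count_space UNIV) = 1"
      using assms by (simp add: prob_vector_def nn_integral_count_space_finite sum_nonneg)
  qed (use assms in \<open>simp add: prob_vector_def\<close>)
qed

text \<open>The chain is driven by independent random maps of the state space: the map used at time
  \<open>t + 1\<close> has independent values distributed as the rows of \<open>P\<close>, the map used at time \<open>0\<close> is
  constant. A path event is then a cylinder, so its probability is a product.\<close>

primrec driven_path :: "(nat \<Rightarrow> 'k \<Rightarrow> 'k) \<Rightarrow> nat \<Rightarrow> 'k" where
  "driven_path f 0 = f 0 undefined"
| "driven_path f (Suc t) = f (Suc t) (driven_path f t)"

text \<open>As long as the path follows \<open>x\<close>, the map at time \<open>s + 1\<close> is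
  applied to the fixed state \<open>x s\<close>. The event therefore splits into one condition per
  coordinate of \<open>f\<close>.\<close>

lemma driven_path_eq_iff:
  "(\<forall>s\<le>t. driven_path f s = x s) \<longleftrightarrow>
   f 0 undefined = x 0 \<and> (\<forall>s<t. f (Suc s) (x s) = x (Suc s))"
  by (induction t) (auto simp: le_Suc_eq less_Suc_eq)

lemma markov_chain_exists:
  fixes P :: "real ^ 'k ^ 'k::finite"
  assumes "stochastic_matrix P" and "prob_vector v"
  obtains M :: "(nat \<Rightarrow> 'k) measure" and X
  where "prob_space M" and "\<And>t. X t \<in> measurable M (count_space UNIV)"
    and "\<And>t x. \<P>(w in M. \<forall>s\<le>t. X s w = x s) = v $ x 0 * (\<Prod>s<t. P $ x s $ x (Suc s))"
proof -
  obtain q where q: "\<And>i. pmf q i = v $ i"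
    using prob_vector_pmf[OF assms(2)] by blast
  have "\<exists>r. \<forall>j. pmf r j = P $ i $ j" for i
    using prob_vector_pmf[of "P $ i"] assms(1) unfolding stochastic_matrix_def by metis
  then obtain r where r: "\<And>i j. pmf (r i) j = P $ i $ j"
    by metis
  \<comment> \<open>The initial law enters as a law on constant maps, so the arbitrary argument
    \<open>undefined\<close> in \<open>driven_path\<close> cannot influence the start.\<close>
  define Q where "Q t = (case t of 0 \<Rightarrow> map_pmf (\<lambda>k _. k) q | Suc _ \<Rightarrow> Pi_pmf UNIV undefined r)" for t :: nat
  interpret product_prob_space "\<lambda>t. measure_pmf (Q t)" UNIV ..
  define \<Omega> where "\<Omega> = PiM UNIV (\<lambda>t. measure_pmf (Q t))"
  have \<Omega>: "prob_space \<Omega>"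
    unfolding \<Omega>_def by (rule prob_space_axioms)
  have path [measurable]: "(\<lambda>f. driven_path f t) \<in> measurable \<Omega> (count_space UNIV)" for t
  proof (induction t)
    case 0
    have "(\<lambda>f. f 0) \<in> measurable \<Omega> (measure_pmf (Q 0))"
      unfolding \<Omega>_def by measurable
    then have "(\<lambda>f. f 0 undefined) \<in> measurable \<Omega> (count_space UNIV)"
      by (rule measurable_compose) simp
    then show ?case by simp
  next
    case (Suc t)
    have *: "(\<lambda>f. f (Suc t)) \<in> measurable \<Omega> (count_space UNIV)"
      unfolding \<Omega>_def
      by (rule measurable_compose[OF measurable_component_singleton[of "Suc t"]]) auto
    \<comment> \<open>Evaluation at a random point stays measurable because that point takes only
      countably many values.\<close>
    have "(\<lambda>f. (f (Suc t)) (driven_path f t)) \<in> measurable \<Omega> (count_space UNIV)"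
      by (rule measurable_compose_countable[OF _ Suc, where f="\<lambda>k f. f (Suc t) k"])
        (rule measurable_compose[OF *], simp)
    then show ?case by simp
  qed
  let ?S = "PiM UNIV (\<lambda>_::nat. count_space (UNIV :: 'k set))"
  have D: "driven_path \<in> measurable \<Omega> ?S"
    by (rule measurable_PiM_single') (auto simp: path)
  show thesis
  proof (rule that[of "distr \<Omega> ?S driven_path" "\<lambda>t w. w t"])
    show "prob_space (distr \<Omega> ?S driven_path)"
      by (rule prob_space.prob_space_distr[OF \<Omega> D])
    show "(\<lambda>w. w t) \<in> measurable (distr \<Omega> ?S driven_path) (count_space UNIV)" for t
      by simp
    fix t :: nat and x :: "nat \<Rightarrow> 'k"
    define A where "A s = (case s of 0 \<Rightarrow> {f. f undefined = x 0} | Suc u \<Rightarrow> {f. f (x u) = x s})" for s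
    have A0: "measure (Q 0) (A 0) = v $ x 0"
      by (simp add: Q_def A_def q[symmetric] vimage_def measure_pmf_single)
    have AS: "measure (Q (Suc u)) (A (Suc u)) = P $ x u $ x (Suc u)" for u
    proof -
      have "measure (Q (Suc u)) (A (Suc u)) = measure (map_pmf (\<lambda>f. f (x u)) (Pi_pmf UNIV undefined r)) {x (Suc u)}"
        by (simp add: Q_def A_def vimage_def)
      also have "\<dots> = P $ x u $ x (Suc u)"
        by (simp add: Pi_pmf_component r measure_pmf_single)
      finally show ?thesis .
    qed
    have "{w \<in> space ?S. \<forall>s\<le>t. w s = x s} \<in> sets ?S"
      by measurable
    then have "\<P>(w in distr \<Omega> ?S driven_path. \<forall>s\<le>t. w s = x s)
        = measure \<Omega> {f. \<forall>s\<le>t. driven_path f s = x s}"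
      by (subst measure_distr[OF D])
        (auto intro!: arg_cong[where f="measure \<Omega>"] simp: \<Omega>_def space_PiM)
    also have "{f. \<forall>s\<le>t. driven_path f s = x s}
        = prod_emb UNIV (\<lambda>t. measure_pmf (Q t)) {..t} (PiE {..t} A)"
    proof -
      have "(f 0 undefined = x 0 \<and> (\<forall>s<t. f (Suc s) (x s) = x (Suc s))) \<longleftrightarrow> (\<forall>s\<in>{..t}. f s \<in> A s)" for f
        unfolding A_def by (auto split: nat.splits)
      then show ?thesis
        unfolding driven_path_eq_iff by (auto simp: prod_emb_def PiE_iff)
    qed
    also have "measure \<Omega> \<dots> = (\<Prod>s\<le>t. measure (Q s) (A s))"
      unfolding \<Omega>_def by (rule measure_PiM_emb) auto
    also have "\<dots> = v $ x 0 * (\<Prod>s<t. P $ x s $ x (Suc s))"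
      by (simp add: prod.atMost_shift A0 AS)
    finally show "\<P>(w in distr \<Omega> ?S driven_path. \<forall>s\<le>t. w s = x s)
      = v $ x 0 * (\<Prod>s<t. P $ x s $ x (Suc s))" .
  qed
qed

text \<open>The chain is started in \<open>v\<close>. Its transition probabilities are quotients of
  consecutive path probabilities, and detailed balance turns a path product into that of the
  reversed path.\<close>

lemma reversible_markov_chain_exists:
  fixes P :: "real ^ 'k ^ 'k::finite"
  assumes P: "stochastic_matrix P" and v: "prob_vector v"
    and balance: "\<And>i j. v $ i * P $ i $ j = v $ j * P $ j $ i"
  shows "\<exists>(M :: (nat \<Rightarrow> 'k) measure) X. markov_chain M X P \<and> time_reversible M X"
proof -
  obtain M :: "(nat \<Rightarrow> 'k) measure" and X where M: "prob_space M"
    and X: "\<And>t. X t \<in> measurable M (count_space UNIV)"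
    and path: "\<And>t x. \<P>(w in M. \<forall>s\<le>t. X s w = x s) = v $ x 0 * (\<Prod>s<t. P $ x s $ x (Suc s))"
    by (rule markov_chain_exists[OF P v], rule that)
  have "\<P>(w in M. X (Suc t) w = x (Suc t) \<bar> \<forall>s\<le>t. X s w = x s) = P $ x t $ x (Suc t)"
    if "\<P>(w in M. \<forall>s\<le>t. X s w = x s) > 0" for t x
  proof -
    let ?a = "v $ x 0 * (\<Prod>s<t. P $ x s $ x (Suc s))"
    have "\<P>(w in M. X (Suc t) w = x (Suc t) \<and> (\<forall>s\<le>t. X s w = x s)) = \<P>(w in M. \<forall>s\<le>Suc t. X s w = x s)"
      by (rule arg_cong[where f="measure M"]) (auto simp: le_Suc_eq)
    also have "\<dots> = ?a * P $ x t $ x (Suc t)"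
      by (simp add: path)
    finally have "\<P>(w in M. X (Suc t) w = x (Suc t) \<bar> \<forall>s\<le>t. X s w = x s) = ?a * P $ x t $ x (Suc t) / ?a"
      unfolding cond_prob_def path by simp
    also have "\<dots> = P $ x t $ x (Suc t)"
      by (rule nonzero_mult_div_cancel_left[OF less_imp_neq[OF that[unfolded path], symmetric]])
    finally show ?thesis .
  qed
  then have "markov_chain M X P"
    using M X P unfolding markov_chain_def by blast
  moreover have "time_reversible M X"
    unfolding time_reversible_def
  proof (intro allI)
    fix t and x :: "nat \<Rightarrow> 'k"
    \<comment> \<open>Each use of \<open>balance\<close> carries the factor \<open>v\<close> across
      one transition and turns that transition round.\<close>
    have rev: "v $ x t * (\<Prod>s<t. P $ x (Suc s) $ x s) = v $ x 0 * (\<Prod>s<t. P $ x s $ x (Suc s))" for t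
    proof (induction t)
      case (Suc t)
      have "v $ x (Suc t) * (\<Prod>s<Suc t. P $ x (Suc s) $ x s)
          = (v $ x t * (\<Prod>s<t. P $ x (Suc s) $ x s)) * P $ x t $ x (Suc t)"
        using balance[of "x t" "x (Suc t)"] by simp
      then show ?case
        by (simp add: Suc)
    qed simp
    have "\<P>(w in M. \<forall>s\<le>t. X (t - s) w = x s) = \<P>(w in M. \<forall>s\<le>t. X s w = x (t - s))"
      by (intro arg_cong[where f="measure M"] Collect_cong conj_cong refl)
        (metis diff_diff_cancel diff_le_self)
    also have "\<dots> = v $ x t * (\<Prod>s<t. P $ x (t - s) $ x (t - Suc s))"
      by (simp add: path)
    also have "(\<Prod>s<t. P $ x (t - s) $ x (t - Suc s)) = (\<Prod>s<t. P $ x (Suc s) $ x s)"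
      by (subst prod.nat_diff_reindex[symmetric])
        (auto intro!: prod.cong simp: Suc_diff_Suc)
    finally show "\<P>(w in M. \<forall>s\<le>t. X s w = x s) = \<P>(w in M. \<forall>s\<le>t. X (t - s) w = x s)"
      by (simp add: path rev)
  qed
  ultimately show ?thesis by blast
qed

text \<open>Summing \<open>balance\<close> over one index shows that \<open>p\<close> is stationary.
  Conversely, the density of a stationary \<open>v\<close> with respect to \<open>p\<close> attains
  its maximum at one state, hence everywhere by irreducibility, and normalisation makes the constant
  1.\<close>

lemma unique_stationary_distribution:
  fixes P :: "real ^ 'k ^ 'k::finite"
  assumes P: "stochastic_matrix P" and p: "prob_vector p"
    and pos: "\<And>i. 0 < p $ i"
    and balance: "\<And>i j. p $ i * P $ i $ j = p $ j * P $ j $ i"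
    and irreducible: "\<And>i j. (i, j) \<in> {(i, j). 0 < P $ i $ j}\<^sup>*"
  shows "stationary_distribution P v \<longleftrightarrow> v = p"
proof
  have row: "(\<Sum>j\<in>UNIV. P $ i $ j) = 1" and nonneg: "0 \<le> P $ i $ j" for i j
    using P by (auto simp: stochastic_matrix_def prob_vector_def)
  have mult: "(w v* P) $ j = (\<Sum>i\<in>UNIV. P $ i $ j * w $ i)" for w j
    by (simp add: vector_matrix_mult_def mult.commute)
  {
    assume vp: "v = p"
    have "(p v* P) $ j = p $ j" for j
    proof -
      have "(p v* P) $ j = (\<Sum>i\<in>UNIV. p $ j * P $ j $ i)"
        unfolding mult by (rule sum.cong) (use balance in \<open>auto simp: mult.commute\<close>)
      then show ?thesis
        by (simp add: row flip: sum_distrib_left)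
    qed
    then have "p v* P = p"
      by (simp add: vec_eq_iff)
    then show "stationary_distribution P v"
      using p vp by (simp add: stationary_distribution_def)
  }
  assume v: "stationary_distribution P v"
  define u where "u i = v $ i / p $ i" for i
  have vu: "v $ i = p $ i * u i" for i
    using pos[of i] by (simp add: u_def)
  have harmonic: "u j = (\<Sum>i\<in>UNIV. P $ j $ i * u i)" for j
  proof -
    have "p $ j * u j = (\<Sum>i\<in>UNIV. P $ i $ j * v $ i)"
      using v mult[of v j] by (simp add: stationary_distribution_def flip: vu)
    also have "\<dots> = (\<Sum>i\<in>UNIV. p $ j * (P $ j $ i * u i))"
    proof (rule sum.cong)
      fix i
      have "P $ i $ j * v $ i = (p $ i * P $ i $ j) * u i"
        by (simp add: vu)
      then show "P $ i $ j * v $ i = p $ j * (P $ j $ i * u i)"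
        by (simp add: balance[of i j])
    qed simp
    finally show ?thesis
      using pos[of j] by (simp flip: sum_distrib_left)
  qed
  define m where "m = Max (range u)"
  have le: "u i \<le> m" for i
    by (simp add: m_def)
  obtain i0 where i0: "u i0 = m"
    using Max_in[of "range u"] unfolding m_def by fastforce
  have "u j = m" for j
    using irreducible[of i0 j]
  proof (induction rule: rtrancl_induct)
    case base
    show ?case by (fact i0)
  next
    case (step y z)
    \<comment> \<open>The gaps \<open>m - u i\<close> are nonnegative and their average under row
      \<open>y\<close> vanishes, so every successor of \<open>y\<close> also attains the
      maximum.\<close>
    have "(\<Sum>i\<in>UNIV. P $ y $ i * (m - u i)) = 0"
      using harmonic[of y] row[of y] step.IH
      by (simp add: right_diff_distrib sum_subtractf flip: sum_distrib_right)
    then have "P $ y $ z * (m - u z) = 0"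
      using nonneg le by (subst (asm) sum_nonneg_eq_0_iff) auto
    then show ?case
      using step.hyps by simp
  qed
  then have vm: "v $ i = m * p $ i" for i
    by (simp add: vu)
  have "(\<Sum>i\<in>UNIV. v $ i) = 1" and "(\<Sum>i\<in>UNIV. p $ i) = 1"
    using v p by (auto simp: stationary_distribution_def prob_vector_def)
  then have "m = 1"
    unfolding vm by (simp flip: sum_distrib_left)
  then show "v = p"
    by (simp add: vec_eq_iff vm)
qed

section \<open>Exponent exchanges and the greedy algorithm\<close>


text \<open>Equality of the two sums excludes negative entries. Any nonzero entry is then at least 1
  and uses up the whole total.\<close>

lemma int_unit_vector:
  fixes v :: "'m::finite \<Rightarrow> int"
  assumes abs: "(\<Sum>a\<in>UNIV. \<bar>v a\<bar>) = 1" and sum: "(\<Sum>a\<in>UNIV. v a) = 1"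
  obtains c where "\<And>a. v a = (if a = c then 1 else 0)"
proof -
  have "(\<Sum>a\<in>UNIV. \<bar>v a\<bar> - v a) = 0"
    by (simp add: sum_subtractf abs sum)
  then have "\<bar>v a\<bar> - v a = 0" for a
    by (subst (asm) sum_nonneg_eq_0_iff) auto
  then have nonneg: "0 \<le> v a" for a
    by (metis abs_ge_zero eq_iff_diff_eq_0)
  obtain c where c: "v c \<noteq> 0"
    using sum by (metis sum.neutral zero_neq_one)
  have split: "v c + (\<Sum>a\<in>UNIV - {c}. v a) = 1"
    using sum by (simp add: sum.remove[of UNIV c])
  moreover have "0 \<le> (\<Sum>a\<in>UNIV - {c}. v a)"
    by (simp add: nonneg sum_nonneg)
  ultimately have vc: "v c = 1" and "(\<Sum>a\<in>UNIV - {c}. v a) = 0"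
    using c nonneg[of c] by linarith+
  then have "\<forall>a\<in>UNIV - {c}. v a = 0"
    by (subst (asm) sum_nonneg_eq_0_iff) (auto simp: nonneg)
  then show thesis
    using vc by (intro that[of c]) auto
qed

locale graded_ladder =
  fixes R :: "'k::finite \<Rightarrow> real" and n :: "'k \<Rightarrow> 'm::finite \<Rightarrow> nat" and d :: int
  assumes R_pos: "\<And>i. 0 < R i"
    and degree: "\<And>i. l1_norm (\<lambda>a. int (n i a)) = d"
    and fine: "fine_ladder n"
begin

text \<open>Additions on both sides avoid truncated subtraction, and the partner index
  \<open>c\<close>, which \<open>nbhd\<close> leaves implicit, becomes visible.\<close>

definition exchange :: "'m \<Rightarrow> 'm \<Rightarrow> 'k \<Rightarrow> 'k \<Rightarrow> bool" where
  "exchange b c i j \<longleftrightarrow>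
     (\<forall>a. n i a + (if a = b then 1 else 0) = n j a + (if a = c then 1 else 0))"

lemma exchange_sym: "exchange b c i j \<longleftrightarrow> exchange c b j i"
  unfolding exchange_def by metis

lemma sum_exponents_diff: "(\<Sum>a\<in>UNIV. int (n i a) - int (n j a)) = 0"
  using degree[of i] degree[of j] by (simp add: l1_norm_def sum_subtractf)

text \<open>All degrees agree, so the vector inside the norm has sum 1. Norm 1 then forces it to be
  a unit vector, whose position is \<open>c\<close>.\<close>

lemma nbhd_iff_exchange: "j \<in> nbhd n b i \<longleftrightarrow> j \<noteq> i \<and> (\<exists>c. exchange b c i j)"
proof (intro iffI conjI)
  let ?v = "\<lambda>a. int (n i a) - int (n j a) + (if a = b then 1 else 0)"
  assume j: "j \<in> nbhd n b i"
  then show "j \<noteq> i"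
    by (simp add: nbhd_def)
  have "(\<Sum>a\<in>UNIV. ?v a) = 1"
    by (simp add: sum.distrib sum_exponents_diff)
  moreover have "(\<Sum>a\<in>UNIV. \<bar>?v a\<bar>) = 1"
    using j by (simp add: nbhd_def l1_norm_def)
  ultimately obtain c where c: "\<And>a. ?v a = (if a = c then 1 else 0)"
    using int_unit_vector[of ?v] by blast
  have "n i a + (if a = b then 1 else 0) = n j a + (if a = c then 1 else 0)" for a
    using c[of a] by (auto split: if_splits)
  then show "\<exists>c. exchange b c i j"
    unfolding exchange_def by blast
next
  assume "j \<noteq> i \<and> (\<exists>c. exchange b c i j)"
  then obtain c where "j \<noteq> i" and c: "exchange b c i j"
    by blast
  have "int (n i a) - int (n j a) + (if a = b then 1 else 0) = (if a = c then 1 else 0)" for a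
    using c[unfolded exchange_def, rule_format, of a] by (auto split: if_splits)
  then show "j \<in> nbhd n b i"
    using \<open>j \<noteq> i\<close> by (simp add: nbhd_def l1_norm_def if_distrib[of abs] cong: if_cong)
qed

lemma exchange_distinct:
  assumes "exchange b c i j" and "i \<noteq> j"
  shows "b \<noteq> c"
proof
  assume "b = c"
  then have "n i = n j"
    using assms(1) by (auto simp: exchange_def)
  then show False
    using assms(2) fine by (auto simp: fine_ladder_def)
qed

text \<open>Since \<open>b\<close> and \<open>c\<close> differ, \<open>n j\<close> exceeds
  \<open>n i\<close> at \<open>b\<close>, and the second exchange can raise an exponent only at
  \<open>b'\<close>.\<close>

lemma exchange_unique:
  assumes "exchange b c i j" and "exchange b' c' i j" and "i \<noteq> j"
  shows "b = b'"
proof -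
  have "b \<noteq> c"
    using exchange_distinct assms by blast
  then have "n j b = Suc (n i b)"
    using assms(1)[unfolded exchange_def, rule_format, of b] by simp
  then show ?thesis
    using assms(2)[unfolded exchange_def, rule_format, of b] by (simp split: if_splits)
qed

lemma nbhd_unique: "j \<in> nbhd n b i \<Longrightarrow> j \<in> nbhd n b' i \<Longrightarrow> b = b'"
  unfolding nbhd_iff_exchange using exchange_unique by blast

lemma nbhd_sym:
  assumes "j \<in> nbhd n b i"
  obtains c where "i \<in> nbhd n c j"
  using assms exchange_sym unfolding nbhd_iff_exchange by blast

lemma not_self_nbhd: "i \<notin> nbhd n b i"
  by (simp add: nbhd_def)

lemma the_nbhd: "j \<in> nbhd n b i \<Longrightarrow> (THE b. j \<in> nbhd n b i) = b"
  by (rule the_equality) (auto dest: nbhd_unique)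

text \<open>The difference is nonzero with sum 0, so some entry is negative. Adding 1 there lowers
  the norm to at most 1, while the new sum 1 bounds it from below.\<close>

lemma nbhd_of_l1_norm_le_2:
  assumes "l1_norm (\<lambda>a. int (n i a) - int (n j a)) \<le> 2" and "i \<noteq> j"
  obtains b where "j \<in> nbhd n b i"
proof -
  let ?v = "\<lambda>a. int (n i a) - int (n j a)"
  have "\<exists>b. ?v b < 0"
  proof (rule ccontr)
    assume "\<nexists>b. ?v b < 0"
    then have "\<forall>a\<in>UNIV. ?v a = 0"
      using sum_exponents_diff[of i j] by (subst (asm) sum_nonneg_eq_0_iff) (auto simp: not_less)
    then have "n i = n j"
      by auto
    then show False
      using assms(2) fine by (auto simp: fine_ladder_def)
  qed
  then obtain b where b: "?v b < 0"
    by blast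
  let ?w = "\<lambda>a. ?v a + (if a = b then 1 else 0)"
  have "\<bar>?w a\<bar> = \<bar>?v a\<bar> - (if a = b then 1 else 0)" for a
    using b by auto
  then have "l1_norm ?w \<le> 1"
    using assms(1) by (simp add: l1_norm_def sum_subtractf)
  moreover have "1 \<le> l1_norm ?w"
    using sum_abs[of ?w UNIV] by (simp add: l1_norm_def sum.distrib sum_exponents_diff)
  ultimately show thesis
    using assms(2) by (intro that[of b]) (simp add: nbhd_def)
qed

section \<open>The effect of one greedy round\<close>

text \<open>These are the elements that leave the working set at \<open>z\<close> once a round at
  \<open>(b, i)\<close> has processed the members of \<open>J\<close>.\<close>

definition resolved :: "'m \<Rightarrow> 'k \<Rightarrow> 'k set \<Rightarrow> 'm \<times> 'k \<Rightarrow> 'k set" where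
  "resolved b i J z =
     (if z = (b, i) then J else if snd z \<in> J \<and> i \<in> nbhd n (fst z) (snd z) then {i} else {})"

text \<open>The criterion is symmetric in \<open>x\<close> and \<open>y\<close> and free of the
  coordinate \<open>a\<close>: a round resolves unordered pairs of states.\<close>

lemma resolved_iff:
  assumes "J \<subseteq> nbhd n b i" and "y \<in> nbhd n a x"
  shows "y \<in> resolved b i J (a, x) \<longleftrightarrow> x = i \<and> y \<in> J \<or> y = i \<and> x \<in> J"
proof -
  have "i \<notin> J"
    using assms(1) not_self_nbhd by blast
  moreover have "a = b" if "x = i" "y \<in> J"
    using that assms nbhd_unique by blast
  ultimately show ?thesis
    using assms(2) by (auto simp: resolved_def)
qed

text \<open>One more processed \<open>j\<close> affects only \<open>(b, i)\<close> and
  \<open>(c, j)\<close>, and the latter was untouched before, so a round visits it at most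
  once.\<close>

lemma resolved_insert:
  assumes "insert j J \<subseteq> nbhd n b i" and "j \<notin> J" and "i \<in> nbhd n c j"
  shows "resolved b i (insert j J) z =
    (if z = (b, i) then insert j J else if z = (c, j) then {i} else resolved b i J z)"
    and "resolved b i J (c, j) = {}"
proof -
  have c: "i \<in> nbhd n a j \<longleftrightarrow> a = c" for a
    using assms(3) nbhd_unique by blast
  have "j \<noteq> i"
    using assms(1) not_self_nbhd by blast
  then show "resolved b i (insert j J) z =
    (if z = (b, i) then insert j J else if z = (c, j) then {i} else resolved b i J z)"
    using assms(2) by (cases z) (auto simp: resolved_def c)
  show "resolved b i J (c, j) = {}"
    using assms(2) \<open>j \<noteq> i\<close> by (simp add: resolved_def)
qed

text \<open>A closed form of the loop over \<open>js\<close> that depends only on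
  \<open>set js\<close>. A score written at \<open>(c, j)\<close> remains valid because that
  position is visited once; \<open>(b, i)\<close> is excluded because its score is reset after the
  loop.\<close>

lemma fold_greedy_process:
  assumes "distinct js" and "set js \<subseteq> nbhd n b i"
    and "st1 = fold (greedy_process R n s b i) js st"
  shows "setM st1 z = setM st z - resolved b i (set js) z"
    and "weight st1 z = weight st z + (\<Sum>y\<in>resolved b i (set js) z. R y) / s"
    and "entryV st1 (x, y) =
      (if x = i \<and> y \<in> set js \<or> y = i \<and> x \<in> set js then R y / s else entryV st (x, y))"
    and "z \<noteq> (b, i) \<Longrightarrow> scoreS st1 z =
      (if resolved b i (set js) z = {} then scoreS st z
       else (\<Sum>h\<in>setM st1 z. R h) / (1 - weight st1 z))"
proof -
  have "\<forall>z x y. setM st1 z = setM st z - resolved b i (set js) z \<and>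
      weight st1 z = weight st z + (\<Sum>y\<in>resolved b i (set js) z. R y) / s \<and>
      entryV st1 (x, y) =
        (if x = i \<and> y \<in> set js \<or> y = i \<and> x \<in> set js then R y / s else entryV st (x, y)) \<and>
      (z \<noteq> (b, i) \<longrightarrow> scoreS st1 z =
        (if resolved b i (set js) z = {} then scoreS st z
         else (\<Sum>h\<in>setM st1 z. R h) / (1 - weight st1 z)))"
    using assms
  \<comment> \<open>Induction from the right, since \<open>fold\<close> applies the last list
    element last.\<close>
  proof (induction js arbitrary: st1 rule: rev_induct)
    case Nil
    have "resolved b i {} z = {}" for z
      by (simp add: resolved_def)
    then show ?case
      using Nil by simp
  next
    case (snoc j js)
    define st0 where "st0 = fold (greedy_process R n s b i) js st"
    have st1: "st1 = greedy_process R n s b i j st0"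
      using snoc.prems by (simp add: st0_def)
    have j: "j \<notin> set js" "j \<in> nbhd n b i" "j \<noteq> i"
      using snoc.prems not_self_nbhd by auto
    obtain c where c: "i \<in> nbhd n c j"
      using nbhd_sym[OF j(2)] .
    note res = resolved_insert[OF _ j(1) c, of b]
    have sub: "insert j (set js) \<subseteq> nbhd n b i"
      using snoc.prems by simp
    have IH: "setM st0 z = setM st z - resolved b i (set js) z"
      "weight st0 z = weight st z + (\<Sum>y\<in>resolved b i (set js) z. R y) / s"
      "entryV st0 (x, y) =
        (if x = i \<and> y \<in> set js \<or> y = i \<and> x \<in> set js then R y / s else entryV st (x, y))"
      "z \<noteq> (b, i) \<Longrightarrow> scoreS st0 z =
        (if resolved b i (set js) z = {} then scoreS st z
         else (\<Sum>h\<in>setM st0 z. R h) / (1 - weight st0 z))" for z x y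
      using snoc.IH[OF _ _ st0_def] snoc.prems by (simp_all del: split_paired_All)
    \<comment> \<open>An empty sum gives quotient 0 for every denominator, which absorbs the
      separate case of an emptied set.\<close>
    have if_eq: "(if A = {} then 0 else (\<Sum>h\<in>A. R h) / w) = (\<Sum>h\<in>A. R h) / w" for A w
      by simp
    have new: "setM st1 = (setM st0)((b, i) := setM st0 (b, i) - {j}, (c, j) := setM st0 (c, j) - {i})"
      "weight st1 = (weight st0)((b, i) := weight st0 (b, i) + R j / s, (c, j) := weight st0 (c, j) + R i / s)"
      "entryV st1 = (entryV st0)((i, j) := R j / s, (j, i) := R i / s)"
      "scoreS st1 = (scoreS st0)((c, j) := (\<Sum>h\<in>setM st1 (c, j). R h) / (1 - weight st1 (c, j)))"
      by (simp_all add: st1 greedy_process_def the_nbhd[OF c] Let_def if_eq del: Diff_eq_empty_iff)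
    have bi: "resolved b i (set js) (b, i) = set js"
      by (simp add: resolved_def)
    have set_eq: "set (js @ [j]) = insert j (set js)"
      by simp
    have setM1: "setM st1 z = setM st z - resolved b i (set (js @ [j])) z" for z
      unfolding new set_eq res(1)[OF sub] using j(3) res(2)[OF sub] by (auto simp: IH(1) bi)
    have weight1: "weight st1 z = weight st z + (\<Sum>y\<in>resolved b i (set (js @ [j])) z. R y) / s" for z
      unfolding new set_eq res(1)[OF sub] using j res(2)[OF sub]
      by (auto simp: IH(2) bi add_divide_distrib)
    have entry1: "entryV st1 (x, y) = (if x = i \<and> y \<in> set (js @ [j]) \<or> y = i \<and> x \<in> set (js @ [j])
        then R y / s else entryV st (x, y))" for x y
      unfolding new using j by (auto simp: IH(3))
    have score1: "scoreS st1 z =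
        (if resolved b i (set (js @ [j])) z = {} then scoreS st z
         else (\<Sum>h\<in>setM st1 z. R h) / (1 - weight st1 z))" if "z \<noteq> (b, i)" for z
    proof (cases "z = (c, j)")
      case True
      then show ?thesis
        using that unfolding set_eq res(1)[OF sub] by (simp add: new(4))
    next
      case False
      then have "setM st1 z = setM st0 z" "weight st1 z = weight st0 z" "scoreS st1 z = scoreS st0 z"
        using that by (simp_all add: new)
      then show ?thesis
        using that False unfolding set_eq res(1)[OF sub] by (simp add: IH(4))
    qed
    show ?case
      using setM1 weight1 entry1 score1 by blast
  qed
  then show "setM st1 z = setM st z - resolved b i (set js) z"
    "weight st1 z = weight st z + (\<Sum>y\<in>resolved b i (set js) z. R y) / s"
    "entryV st1 (x, y) =
      (if x = i \<and> y \<in> set js \<or> y = i \<and> x \<in> set js then R y / s else entryV st (x, y))"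
    "z \<noteq> (b, i) \<Longrightarrow> scoreS st1 z =
      (if resolved b i (set js) z = {} then scoreS st z
       else (\<Sum>h\<in>setM st1 z. R h) / (1 - weight st1 z))"
    by blast+
qed

section \<open>Invariant and termination of the greedy algorithm\<close>

text \<open>If \<open>M\<^sub>b(i)\<close> is empty, the formula for \<open>S\<^sub>b(i)\<close> gives \<open>0\<close> even when the weight is \<open>1\<close>, because
  \<open>0 / 0 = 0\<close>.\<close>

definition greedy_inv :: "('k, 'm) greedy_state \<Rightarrow> bool" where
  "greedy_inv st \<longleftrightarrow>
     (\<forall>b i. setM st (b, i) \<subseteq> nbhd n b i) \<and>
     (\<forall>b c i j. j \<in> setM st (b, i) \<longrightarrow> i \<in> nbhd n c j \<longrightarrow> i \<in> setM st (c, j)) \<and>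
     (\<forall>z. scoreS st z = (\<Sum>j\<in>setM st z. R j) / (1 - weight st z)) \<and>
     (\<forall>z. weight st z \<le> 1 \<and> (setM st z \<noteq> {} \<longrightarrow> weight st z < 1)) \<and>
     (\<forall>b i. weight st (b, i) = (\<Sum>j\<in>nbhd n b i - setM st (b, i). entryV st (i, j))) \<and>
     (\<forall>b i. \<forall>j\<in>nbhd n b i - setM st (b, i).
        0 < entryV st (i, j) \<and> R i * entryV st (i, j) = R j * entryV st (j, i))"

lemma greedy_inv_init: "greedy_inv (greedy_init R n)"
  by (auto simp: greedy_inv_def greedy_init_def)

text \<open>A nonempty working set has positive rates and weight below 1, hence a positive score,
  whereas an empty one scores 0. This makes division by the maximal score safe.\<close>

lemma maximal_score:
  assumes inv: "greedy_inv st" and ex: "\<exists>x. setM st x \<noteq> {}"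
    and max: "\<forall>x. scoreS st x \<le> scoreS st z"
  shows "0 < scoreS st z" and "setM st z \<noteq> {}"
proof -
  have score: "scoreS st z = (\<Sum>j\<in>setM st z. R j) / (1 - weight st z)" for z
    using inv unfolding greedy_inv_def by blast
  obtain x where x: "setM st x \<noteq> {}"
    using ex by blast
  then have "0 < (\<Sum>j\<in>setM st x. R j)"
    by (simp add: sum_pos R_pos)
  moreover have "weight st x < 1"
    using inv x unfolding greedy_inv_def by metis
  ultimately have "0 < scoreS st x"
    by (simp add: score)
  then show "0 < scoreS st z"
    using max by (meson less_le_trans)
  then show "setM st z \<noteq> {}"
    using score[of z] by auto
qed

text \<open>The closed form of a round reduces each clause to the removed sets \<open>D z\<close>.
  The total size drops because the nonempty set at \<open>(b, i)\<close> is emptied.\<close>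

lemma greedy_inv_step:
  assumes inv: "greedy_inv st" and ex: "\<exists>x. setM st x \<noteq> {}"
    and max: "\<forall>x. scoreS st x \<le> scoreS st (b, i)"
    and js: "distinct js" "set js = setM st (b, i)"
    and st1: "st1 = fold (greedy_process R n (scoreS st (b, i)) b i) js st"
  shows "greedy_inv (st1\<lparr>scoreS := (scoreS st1)((b, i) := 0)\<rparr>)" (is ?inv)
    and "(\<Sum>z\<in>UNIV. card (setM st1 z)) < (\<Sum>z\<in>UNIV. card (setM st z))" (is ?less)
proof -
  define J where "J = setM st (b, i)"
  define s where "s = scoreS st (b, i)"
  define D where "D = resolved b i J"
  have sub: "setM st (b, i) \<subseteq> nbhd n b i"
    and symM: "j \<in> setM st (b, i) \<Longrightarrow> i \<in> nbhd n c j \<Longrightarrow> i \<in> setM st (c, j)"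
    and score: "scoreS st z = (\<Sum>j\<in>setM st z. R j) / (1 - weight st z)"
    and weight_le: "weight st z \<le> 1"
    and weight_less: "setM st z \<noteq> {} \<Longrightarrow> weight st z < 1"
    and weight_sum: "weight st (b, i) = (\<Sum>j\<in>nbhd n b i - setM st (b, i). entryV st (i, j))"
    and entry_pos: "j \<in> nbhd n b i - setM st (b, i) \<Longrightarrow> 0 < entryV st (i, j)"
    and entry_sym: "j \<in> nbhd n b i - setM st (b, i) \<Longrightarrow> R i * entryV st (i, j) = R j * entryV st (j, i)"
    for b i c j z
    using inv unfolding greedy_inv_def by blast+
  have s: "0 < s" and J: "J \<noteq> {}"
    using maximal_score[OF inv ex max] by (auto simp: s_def J_def)
  have JN: "J \<subseteq> nbhd n b i"
    using sub by (simp add: J_def)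
  note fold = fold_greedy_process[OF js(1) JN[unfolded J_def, folded js(2)] st1, unfolded js(2), folded s_def J_def, folded D_def]
  have D_iff: "y \<in> D (a, x) \<longleftrightarrow> x = i \<and> y \<in> J \<or> y = i \<and> x \<in> J" if "y \<in> nbhd n a x" for a x y
    unfolding D_def by (rule resolved_iff[OF JN that])
  \<comment> \<open>By the symmetry clause of the invariant, whatever is removed was still
    unresolved, so no pair is counted twice.\<close>
  have DM: "D z \<subseteq> setM st z" for z
    using symM[of _ b i] by (cases z) (auto simp: D_def resolved_def J_def)
  have entry: "entryV st1 (x, y) = (if y \<in> D (a, x) then R y / s else entryV st (x, y))"
    if "y \<in> nbhd n a x" for a x y
    by (simp add: fold(3) D_iff[OF that])
  have "weight st1 z \<le> 1 \<and> (setM st1 z \<noteq> {} \<longrightarrow> weight st1 z < 1)" for z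
  proof (cases "setM st z = {}")
    case True
    then show ?thesis
      using DM[of z] weight_le[of z] by (simp add: fold)
  next
    case False
    have "(\<Sum>y\<in>setM st z. R y) / (1 - weight st z) \<le> s"
      using max[rule_format, of z] score[of z] by (simp add: s_def)
    then have *: "(\<Sum>y\<in>setM st z. R y) \<le> s * (1 - weight st z)"
      using weight_less[OF False] by (simp add: divide_le_eq)
    have "(\<Sum>y\<in>D z. R y) \<le> (\<Sum>y\<in>setM st z. R y)"
      using DM[of z] R_pos by (intro sum_mono2) (auto intro: less_imp_le)
    then have le: "(\<Sum>y\<in>D z. R y) / s \<le> 1 - weight st z"
      using * s by (simp add: divide_le_eq mult.commute)
    \<comment> \<open>Elements that stay have positive total rate, which makes the bound strict and
      keeps the denominator \<open>1 - weight st1 z\<close> positive.\<close>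
    have less: "(\<Sum>y\<in>D z. R y) / s < 1 - weight st z" if "setM st1 z \<noteq> {}"
    proof -
      have "(\<Sum>y\<in>setM st z. R y) = (\<Sum>y\<in>D z. R y) + (\<Sum>y\<in>setM st1 z. R y)"
        using DM[of z] by (simp add: fold(1) sum.subset_diff add.commute)
      moreover have "0 < (\<Sum>y\<in>setM st1 z. R y)"
        using that by (simp add: sum_pos R_pos)
      ultimately show ?thesis
        using * s by (simp add: divide_less_eq mult.commute)
    qed
    show ?thesis
      using le less by (force simp: fold(2))
  qed
  moreover have "setM st1 (a, x) \<subseteq> nbhd n a x" for a x
    using sub[of a x] by (auto simp: fold(1))
  moreover have "x \<in> setM st1 (c, y)" if y: "y \<in> setM st1 (a, x)" and x: "x \<in> nbhd n c y" for a c x y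
  proof -
    have "y \<in> nbhd n a x" "y \<in> setM st (a, x)" "y \<notin> D (a, x)"
      using y sub by (auto simp: fold(1))
    then show ?thesis
      using symM[OF _ x] D_iff[OF x] D_iff[of y a x] by (auto simp: fold(1))
  qed
  moreover have "((scoreS st1)((b, i) := 0)) z = (\<Sum>j\<in>setM st1 z. R j) / (1 - weight st1 z)" for z
  proof (cases "z = (b, i)")
    case True
    \<comment> \<open>The set here is now empty, so the assigned score 0 agrees with the quotient
      formula.\<close>
    then have "setM st1 z = {}"
      by (simp add: fold(1) D_def resolved_def J_def)
    then show ?thesis
      using True by simp
  next
    case False
    then show ?thesis
      by (simp add: fold(4)) (simp add: fold(1,2) score)
  qed
  moreover have "weight st1 (a, x) = (\<Sum>y\<in>nbhd n a x - setM st1 (a, x). entryV st1 (x, y))" for a x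
  proof -
    have "(\<Sum>y\<in>nbhd n a x - setM st1 (a, x). entryV st1 (x, y))
        = (\<Sum>y\<in>(nbhd n a x - setM st (a, x)) \<union> D (a, x). entryV st1 (x, y))"
      using DM[of "(a, x)"] sub[of a x] by (intro sum.cong) (auto simp: fold(1))
    also have "\<dots> = (\<Sum>y\<in>nbhd n a x - setM st (a, x). entryV st1 (x, y)) + (\<Sum>y\<in>D (a, x). entryV st1 (x, y))"
      using DM[of "(a, x)"] by (intro sum.union_disjoint) auto
    also have "(\<Sum>y\<in>nbhd n a x - setM st (a, x). entryV st1 (x, y)) = weight st (a, x)"
      unfolding weight_sum using DM[of "(a, x)"] by (intro sum.cong) (auto simp: entry)
    also have "(\<Sum>y\<in>D (a, x). entryV st1 (x, y)) = (\<Sum>y\<in>D (a, x). R y) / s"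
      unfolding sum_divide_distrib using DM[of "(a, x)"] sub[of a x]
      by (intro sum.cong refl) (auto simp: entry[of _ a x])
    finally show ?thesis
      by (simp add: fold(2))
  qed
  moreover have "0 < entryV st1 (x, y) \<and> R x * entryV st1 (x, y) = R y * entryV st1 (y, x)"
    if y: "y \<in> nbhd n a x - setM st1 (a, x)" for a x y
  proof -
    obtain c where c: "x \<in> nbhd n c y"
      using nbhd_sym y by blast
    \<comment> \<open>Both entries of a pair are written in the same round, so the balance compares
      two new values over the same \<open>s\<close> or two old ones.\<close>
    have "x \<in> D (c, y) \<longleftrightarrow> y \<in> D (a, x)"
      using D_iff[OF c] D_iff[of y a x] y by auto
    then show ?thesis
      using y entry[OF c] entry[of y a x] entry_pos[of y a x] entry_sym[of y a x] R_pos[of y] s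
      by (auto simp: fold(1))
  qed
  ultimately show ?inv
    unfolding greedy_inv_def by simp blast
  show ?less
  proof (rule sum_strict_mono_ex1)
    show "\<forall>z\<in>UNIV. card (setM st1 z) \<le> card (setM st z)"
      by (auto simp: fold(1) intro: card_mono)
    have "setM st1 (b, i) = {}"
      by (simp add: fold(1) D_def resolved_def J_def)
    then show "\<exists>z\<in>UNIV. card (setM st1 z) < card (setM st z)"
      using J unfolding J_def by (metis UNIV_I card.empty card_gt_0_iff finite)
  qed simp
qed

lemma greedy_inv_reachable:
  assumes "(greedy_step R n)\<^sup>*\<^sup>* st st'" and "greedy_inv st"
  shows "greedy_inv st'"
  using assms
proof (induction rule: rtranclp_induct)
  case (step st st')
  from step.hyps(2) show ?case
  proof cases
    case (1 b i js st1)
    then show ?thesis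
      using greedy_inv_step(1)[OF step.IH[OF step.prems] 1(2-6)] by simp
  qed
qed

text \<open>Induction on the total size of the working sets; finiteness supplies a maximiser and a
  processing order for each round.\<close>

lemma greedy_terminates:
  assumes "greedy_inv st"
  shows "\<exists>st'. (greedy_step R n)\<^sup>*\<^sup>* st st' \<and> (\<forall>x. setM st' x = {})"
  using assms
proof (induction "\<Sum>z\<in>UNIV. card (setM st z)" arbitrary: st rule: less_induct)
  case less
  show ?case
  proof (cases "\<exists>x. setM st x \<noteq> {}")
    case False
    then show ?thesis
      by blast
  next
    case True
    have "Max (range (scoreS st)) \<in> range (scoreS st)"
      by (rule Max_in) auto
    then obtain b i where "scoreS st (b, i) = Max (range (scoreS st))"
      by fastforce
    then have max: "\<forall>x. scoreS st x \<le> scoreS st (b, i)"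
      by simp
    obtain js where js: "distinct js" "set js = setM st (b, i)"
      using finite_distinct_list[of "setM st (b, i)"] by auto
    define st1 where "st1 = fold (greedy_process R n (scoreS st (b, i)) b i) js st"
    let ?st = "st1\<lparr>scoreS := (scoreS st1)((b, i) := 0)\<rparr>"
    have step: "greedy_step R n st ?st"
      by (rule greedy_step.intros[OF True max js st1_def])
    have "(\<Sum>z\<in>UNIV. card (setM ?st z)) < (\<Sum>z\<in>UNIV. card (setM st z))"
      using greedy_inv_step(2)[OF less.prems True max js st1_def] by simp
    then obtain st' where "(greedy_step R n)\<^sup>*\<^sup>* ?st st'" "\<forall>x. setM st' x = {}"
      using less.hyps greedy_inv_step(1)[OF less.prems True max js st1_def] by blast
    then show ?thesis
      using step by (meson converse_rtranclp_into_rtranclp)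
  qed
qed

lemma greedy_output_exists: "\<exists>V. greedy_output R n V"
  unfolding greedy_output_def using greedy_terminates[OF greedy_inv_init] by blast

text \<open>At the end all working sets are empty, so the invariant speaks about entire
  neighbourhoods.\<close>

lemma greedy_outputD:
  assumes "greedy_output R n V"
  shows "(\<Sum>j\<in>nbhd n b i. V $ i $ j) \<le> 1"
    and "j \<in> nbhd n b i \<Longrightarrow> 0 < V $ i $ j"
    and "j \<in> nbhd n b i \<Longrightarrow> R i * V $ i $ j = R j * V $ j $ i"
proof -
  obtain st where st: "(greedy_step R n)\<^sup>*\<^sup>* (greedy_init R n) st" "\<And>x. setM st x = {}"
    and V: "\<And>i j. V $ i $ j = entryV st (i, j)"
    using assms unfolding greedy_output_def by auto
  have "greedy_inv st"
    by (rule greedy_inv_reachable[OF st(1) greedy_inv_init])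
  then have inv: "weight st (b, i) \<le> 1"
    "weight st (b, i) = (\<Sum>j\<in>nbhd n b i. entryV st (i, j))"
    "\<forall>j\<in>nbhd n b i. 0 < entryV st (i, j) \<and> R i * entryV st (i, j) = R j * entryV st (j, i)" for b i
    unfolding greedy_inv_def by (auto simp: st(2))
  show "(\<Sum>j\<in>nbhd n b i. V $ i $ j) \<le> 1"
    and "j \<in> nbhd n b i \<Longrightarrow> 0 < V $ i $ j"
    and "j \<in> nbhd n b i \<Longrightarrow> R i * V $ i $ j = R j * V $ j $ i"
    unfolding V using inv[of b i] by auto
qed

section \<open>The transition matrix of the ladder\<close>

lemma weightW_nbhd: "j \<in> nbhd n b i \<Longrightarrow> weightW n p i j = p $ b"
  using the_nbhd[of j b i] unfolding weightW_def by auto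

lemma weightW_eq_0: "(\<And>b. j \<notin> nbhd n b i) \<Longrightarrow> weightW n p i j = 0"
  by (simp add: weightW_def)

text \<open>The sets \<open>nbhd n b i\<close> are disjoint for different \<open>b\<close>. For
  \<open>p\<close> in the simplex the off-diagonal mass is thus an average of group sums, each at
  most 1 for a greedy output.\<close>

lemma row_sum:
  "(\<Sum>h\<in>UNIV - {i}. V $ i $ h * weightW n p i h) = (\<Sum>b\<in>UNIV. p $ b * (\<Sum>h\<in>nbhd n b i. V $ i $ h))"
proof -
  have "V $ i $ h * weightW n p i h = (\<Sum>b\<in>UNIV. if h \<in> nbhd n b i then p $ b * V $ i $ h else 0)" for h
  proof (cases "\<exists>b. h \<in> nbhd n b i")
    case True
    then obtain b where b: "h \<in> nbhd n b i"
      by blast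
    have "h \<in> nbhd n b' i \<longleftrightarrow> b' = b" for b'
      using b nbhd_unique by blast
    then show ?thesis
      by (simp add: weightW_nbhd[OF b])
  qed (simp add: weightW_eq_0)
  then have "(\<Sum>h\<in>UNIV - {i}. V $ i $ h * weightW n p i h)
      = (\<Sum>b\<in>UNIV. \<Sum>h\<in>UNIV - {i}. if h \<in> nbhd n b i then p $ b * V $ i $ h else 0)"
    by (subst sum.swap) simp
  also have "\<dots> = (\<Sum>b\<in>UNIV. \<Sum>h\<in>nbhd n b i. p $ b * V $ i $ h)"
    using not_self_nbhd[of i] by (intro sum.cong sum.mono_neutral_cong_right) auto
  finally show ?thesis
    by (simp add: sum_distrib_left)
qed

text \<open>Both sides are the same monomial: the extra factor raises one exponent by 1.\<close>

lemma monomial_exchange: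
  fixes p :: "real ^ 'm"
  assumes "exchange b c i j"
  shows "(\<Prod>a\<in>UNIV. p $ a ^ n i a) * p $ b = (\<Prod>a\<in>UNIV. p $ a ^ n j a) * p $ c"
proof -
  \<comment> \<open>Here \<open>b\<close> and \<open>i\<close> are generalised, so that the identity
    rewrites both sides of the goal.\<close>
  have "(\<Prod>a\<in>UNIV. p $ a ^ n i a) * p $ b = (\<Prod>a\<in>UNIV. p $ a ^ (n i a + (if a = b then 1 else 0)))"
    for b i
  proof -
    have "p $ a ^ (n i a + (if a = b then 1 else 0)) = p $ a ^ n i a * (if a = b then p $ b else 1)" for a
      by simp
    then show ?thesis
      by (simp only: prod.distrib) simp
  qed
  then show ?thesis
    using assms by (simp add: exchange_def)
qed

context
  fixes V and p :: "real ^ 'm"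
  assumes V: "greedy_output R n V" and p: "p \<in> open_simplex"
begin

lemma ladder_matrix_pos: "j \<in> nbhd n b i \<Longrightarrow> 0 < ladder_matrix V n p $ i $ j"
proof -
  assume j: "j \<in> nbhd n b i"
  then have "i \<noteq> j"
    using not_self_nbhd by blast
  moreover have "0 < p $ b"
    using p by (simp add: open_simplex_def)
  ultimately show ?thesis
    using greedy_outputD(2)[OF V j] by (simp add: ladder_matrix_def weightW_nbhd[OF j])
qed

lemma stochastic_ladder_matrix: "stochastic_matrix (ladder_matrix V n p)"
  unfolding stochastic_matrix_def prob_vector_def
proof (intro allI conjI)
  fix i j
  show "0 \<le> ladder_matrix V n p $ i $ j"
  proof (cases "i = j")
    case True
    have "0 \<le> p $ b" for b
      using p by (simp add: open_simplex_def less_imp_le)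
    then have "(\<Sum>b\<in>UNIV. p $ b * (\<Sum>h\<in>nbhd n b i. V $ i $ h)) \<le> (\<Sum>b\<in>UNIV. p $ b * 1)"
      by (intro sum_mono mult_left_mono greedy_outputD(1)[OF V])
    then show ?thesis
      using True p by (simp add: ladder_matrix_def row_sum open_simplex_def)
  next
    case False
    show ?thesis
    proof (cases "\<exists>b. j \<in> nbhd n b i")
      case True
      then show ?thesis
        using ladder_matrix_pos[of j _ i] less_imp_le by blast
    qed (use False in \<open>simp add: ladder_matrix_def weightW_eq_0\<close>)
  qed
next
  fix i
  show "(\<Sum>j\<in>UNIV. ladder_matrix V n p $ i $ j) = 1"
    by (simp add: sum.remove[of UNIV i] ladder_matrix_def)
qed

text \<open>The greedy entries balance the constants \<open>R\<close>, and the exchange of exponents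
  balances the monomials.\<close>

lemma ladder_matrix_balance:
  "(R i * (\<Prod>a\<in>UNIV. p $ a ^ n i a)) * ladder_matrix V n p $ i $ j
   = (R j * (\<Prod>a\<in>UNIV. p $ a ^ n j a)) * ladder_matrix V n p $ j $ i"
proof (cases "\<exists>b. i \<noteq> j \<and> j \<in> nbhd n b i")
  case True
  then obtain b c where "i \<noteq> j" and b: "j \<in> nbhd n b i" and ex: "exchange b c i j"
    unfolding nbhd_iff_exchange by blast
  then have c: "i \<in> nbhd n c j"
    unfolding nbhd_iff_exchange using exchange_sym by blast
  have "(R i * (\<Prod>a\<in>UNIV. p $ a ^ n i a)) * ladder_matrix V n p $ i $ j
      = (R i * V $ i $ j) * ((\<Prod>a\<in>UNIV. p $ a ^ n i a) * p $ b)"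
    using \<open>i \<noteq> j\<close> by (simp add: ladder_matrix_def weightW_nbhd[OF b])
  also have "\<dots> = (R j * V $ j $ i) * ((\<Prod>a\<in>UNIV. p $ a ^ n j a) * p $ c)"
    by (simp only: greedy_outputD(3)[OF V b] monomial_exchange[OF ex])
  finally show ?thesis
    using \<open>i \<noteq> j\<close> by (simp add: ladder_matrix_def weightW_nbhd[OF c])
next
  case False
  show ?thesis
  proof (cases "i = j")
    case ne: False
    have "j \<notin> nbhd n b i" "i \<notin> nbhd n b j" for b
      using False ne nbhd_sym[of i _ j] by blast+
    then show ?thesis
      using ne by (simp add: ladder_matrix_def weightW_eq_0)
  qed simp
qed

lemma ladder_matrix_irreducible:
  assumes "connected_ladder n"
  shows "(i, j) \<in> {(i, j). 0 < ladder_matrix V n p $ i $ j}\<^sup>*" (is "_ \<in> ?E\<^sup>*")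
proof -
  obtain ss where ss: "ss \<noteq> []" "hd ss = i" "last ss = j"
    and step: "\<And>h. Suc h < length ss \<Longrightarrow>
      l1_norm (\<lambda>a. int (n (ss ! Suc h) a) - int (n (ss ! h) a)) \<le> 2"
    using assms unfolding connected_ladder_def by blast
  have "(i, ss ! h) \<in> ?E\<^sup>*" if "h < length ss" for h
    using that
  proof (induction h)
    case 0
    then show ?case
      using ss by (simp add: hd_conv_nth)
  next
    case (Suc h)
    show ?case
    \<comment> \<open>Consecutive states of a connecting sequence may coincide; such a step adds no
      transition.\<close>
    proof (cases "ss ! Suc h = ss ! h")
      case False
      \<comment> \<open>Connectedness compares the later state with the earlier one, so the
        neighbour relation is turned round by \<open>nbhd_sym\<close>.\<close>
      then obtain b where "ss ! h \<in> nbhd n b (ss ! Suc h)"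
        using nbhd_of_l1_norm_le_2[OF step[OF Suc.prems]] by metis
      then obtain c where "ss ! Suc h \<in> nbhd n c (ss ! h)"
        by (rule nbhd_sym)
      then have "(ss ! h, ss ! Suc h) \<in> ?E"
        using ladder_matrix_pos by simp
      then show ?thesis
        using Suc by (meson Suc_lessD rtrancl.rtrancl_into_rtrancl)
    qed (use Suc in simp)
  qed
  from this[of "length ss - 1"] show ?thesis
    using ss by (simp add: last_conv_nth)
qed

end

end

theorem proposition3p4:
  fixes \<pi> :: "real ^ 'm::finite \<Rightarrow> real ^ 'k::finite"
    and R :: "'k \<Rightarrow> real" and n :: "'k \<Rightarrow> 'm \<Rightarrow> nat" and C :: "real ^ 'm \<Rightarrow> real"
  assumes "multivariate_ladder \<pi> R n C"
    and "fine_ladder n"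
    and "connected_ladder n"
  shows "(\<exists>V. greedy_output R n V) \<and>
    (\<forall>V. greedy_output R n V \<longrightarrow> (\<forall>p \<in> open_simplex.
       (\<exists>(M :: (nat \<Rightarrow> 'k) measure) X.
          markov_chain M X (ladder_matrix V n p) \<and> time_reversible M X) \<and>
       (\<forall>v. stationary_distribution (ladder_matrix V n p) v \<longleftrightarrow> v = \<pi> p)))"
proof -
  obtain d where d: "\<And>i. l1_norm (\<lambda>a. int (n i a)) = d"
    using assms(1) unfolding multivariate_ladder_def by blast
  interpret graded_ladder R n d
    using assms(1,2) d by unfold_locales (auto simp: multivariate_ladder_def)
  show ?thesis
  proof (intro conjI allI impI ballI)
    show "\<exists>V. greedy_output R n V"
      by (rule greedy_output_exists)
  next
    fix V and p :: "real ^ 'm"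
    assume V: "greedy_output R n V" and p: "p \<in> open_simplex"
    let ?P = "ladder_matrix V n p"
    have \<pi>: "\<pi> p \<in> open_simplex"
      and \<pi>_eq: "\<pi> p $ i = R i * (\<Prod>j\<in>UNIV. (p $ j) ^ n i j) / C p" for i
      using assms(1) p by (auto simp: multivariate_ladder_def)
    have pos: "0 < \<pi> p $ i" for i
      using \<pi> by (simp add: open_simplex_def)
    have prob: "prob_vector (\<pi> p)"
      using \<pi> by (auto simp: open_simplex_def prob_vector_def intro: less_imp_le)
    \<comment> \<open>The common denominator \<open>C p\<close> scales both sides alike.\<close>
    have balance: "\<pi> p $ i * ?P $ i $ j = \<pi> p $ j * ?P $ j $ i" for i j
      using ladder_matrix_balance[OF V p, of i j] by (simp add: \<pi>_eq)
    note P = stochastic_ladder_matrix[OF V p]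
    show "\<exists>(M :: (nat \<Rightarrow> 'k) measure) X. markov_chain M X ?P \<and> time_reversible M X"
      by (rule reversible_markov_chain_exists[OF P prob balance])
    show "stationary_distribution ?P v \<longleftrightarrow> v = \<pi> p" for v
      by (rule unique_stationary_distribution[OF P prob pos balance
            ladder_matrix_irreducible[OF V p assms(3)]])
  qed
qed

end
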